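(* Consider the system of Volterra integral equations $$x_k(t)=\sum_{l=1}^n\int_0^t b_{kl}(t,\tau)x_l(\tau)\,d\tau,\qquad k=1,\dots,n,\ 0\le t<\infty, \qquad (\ast)$$ where the functions $b_{kl}(t,\tau)$, $k,l=1,\dots,n$, are differentiable with respect to the first variable, and the perturbed system $$x_k(t)=\sum_{l=1}^n\int_0^t b_{kl}(t,\tau)x_l(\tau)\,d\tau+f_k(t),\qquad k=1,\dots,n, \qquad (\ast\ast)$$ where $F(t)=(f_1(t),\dots,f_n(t))$ is a continuously differentiable vector function, and the values $f_k(0)$ are not necessarily equal to zero. Put $B(t)=\{b_{kl}(t,t)\}_{k,l=1}^n$ and $C(t,\tau)=\{\frac{\partial}{\partial t}b_{kl}(t,\tau)\}_{k,l=1}^n$. Let $\delta_1(\varepsilon)>0$ and $\delta_2(\varepsilon)>0$ be the bounds on the perturbation: $\sup_{t\in[0,\infty)}\|F'(t)\|\le\delta_1(\varepsilon)$ and $\|X(0)\|=\|F(0)\|\le\delta_2(\varepsilon)$. Let for any $t,t^*\in[0,\infty)$, $t^*\ge0$, $t>t^*$, the following inequalities be fulfilled: 1) $$\Lambda(B(t))+\frac{1}{t-t^*}\int_{t^*}^t\varphi^*(\tau)\,d\tau<0,$$ where $$\varphi^*(s)=\int_0^s\|C(s,\tau)\|\,d\tau+\frac{\|F'(s)\|}{\varepsilon}\le\int_0^s\|C(s,\tau)\|\,d\tau+\frac{\delta_1(\varepsilon)}{\varepsilon};$$ 2) $\delta_2(\varepsilon)\le\varepsilon$, and let $\varepsilon>0$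 be a sufficiently small positive number. Then the trivial solution of the system $(\ast)$ is stable, and $\|X(t)\|\le\varepsilon$ for $t\in[0,\infty)$, where $X(t)=(x_1(t),\dots,x_n(t))$ is the solution of the perturbed system $(\ast\ast)$.
   Context: Vector functions $X(t)=(x_1(t),\dots,x_n(t))$ are measured by $\|X(t)\|=\max_{1\le k\le n}|x_k(t)|$; for matrices $\|\cdot\|$ is the corresponding operator norm. The logarithmic norm of a matrix $A$ is $\Lambda(A)=\lim_{h\downarrow0}(\|I+hA\|-1)h^{-1}$, with $I$ the identity; for the max-norm, $\Lambda(A)=\max_{1\le i\le n}\bigl(a_{ii}+\sum_{j\ne i}|a_{ij}|\bigr)$. Definition of stability used here (perturbations not required to vanish at $0$): the trivial solution of $(\ast)$ is stable if for any arbitrarily small $\varepsilon>0$ there exist $\delta_i(\varepsilon)>0$, $i=1,2$, with $\delta_2(\varepsilon)\le\varepsilon$, such that $\sup_{t\in[0,\infty)}\|F'(t)\|\le\delta_1(\varepsilon)$ and $\|X(0)\|=\|F(0)\|\le\delta_2(\varepsilon)$ imply $\sup_{t\in[0,\infty)}\|X(t)\|\le\varepsilon$, where $X(t)$ is the solution of the perturbed system $(\ast\ast)$. *)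

theory Defs
  imports "HOL-Analysis.Analysis"
begin

text \<open>
  The norm of \<open>real ^ 'n\<close> in the library is Euclidean; the max-norm is \<^const>\<open>infnorm\<close>. The operator
  norm below is \<^const>\<open>onorm\<close> with \<^const>\<open>infnorm\<close> in place of \<^const>\<open>norm\<close>.
\<close>

definition op_infnorm :: "real ^ 'n ^ 'n \<Rightarrow> real" where
  "op_infnorm A = (SUP x. infnorm (A *v x) / infnorm x)"

definition log_norm :: "real ^ 'n ^ 'n \<Rightarrow> real" where
  "log_norm A = Lim (at_right 0) (\<lambda>h. (op_infnorm (mat 1 + h *\<^sub>R A) - 1) / h)"

text \<open>
  A kernel \<open>b k l t \<tau>\<close> is only looked at for \<open>0 \<le> \<tau> \<le> t\<close>. Hence its derivative in \<open>t\<close> is taken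
  within \<open>{\<tau>..}\<close>, which is one-sided on the diagonal; likewise perturbations live on \<open>{0..}\<close>.
\<close>

definition kernel_diag :: "('n \<Rightarrow> 'n \<Rightarrow> real \<Rightarrow> real \<Rightarrow> real) \<Rightarrow> real \<Rightarrow> real ^ 'n ^ 'n" where
  "kernel_diag b t = (\<chi> k l. b k l t t)"

definition kernel_deriv :: "('n \<Rightarrow> 'n \<Rightarrow> real \<Rightarrow> real \<Rightarrow> real) \<Rightarrow> real \<Rightarrow> real \<Rightarrow> real ^ 'n ^ 'n" where
  "kernel_deriv b t \<tau> = (\<chi> k l. vector_derivative (\<lambda>s. b k l s \<tau>) (at t within {\<tau>..}))"

text \<open>
  Besides differentiability in the first variable, a kernel is only required to make the
  integrals occurring in the equation and in the stability condition exist (as Lebesgue integrals;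
  the last two integrands are nonnegative). No continuity in the second variable is assumed.
\<close>

definition volterra_kernel :: "('n::finite \<Rightarrow> 'n \<Rightarrow> real \<Rightarrow> real \<Rightarrow> real) \<Rightarrow> bool" where
  "volterra_kernel b \<longleftrightarrow>
     (\<forall>k l \<tau> t. 0 \<le> \<tau> \<longrightarrow> \<tau> \<le> t \<longrightarrow> (\<lambda>s. b k l s \<tau>) differentiable (at t within {\<tau>..})) \<and>
     (\<forall>k l t. 0 \<le> t \<longrightarrow> b k l t absolutely_integrable_on {0..t}) \<and>
     (\<forall>s\<ge>0. (\<lambda>\<tau>. op_infnorm (kernel_deriv b s \<tau>)) integrable_on {0..s}) \<and>
     (\<forall>T\<ge>0. (\<lambda>s. integral {0..s} (\<lambda>\<tau>. op_infnorm (kernel_deriv b s \<tau>))) integrable_on {0..T})"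

definition volterra_solution ::
    "('n::finite \<Rightarrow> 'n \<Rightarrow> real \<Rightarrow> real \<Rightarrow> real) \<Rightarrow> (real \<Rightarrow> real ^ 'n) \<Rightarrow> (real \<Rightarrow> real ^ 'n) \<Rightarrow> bool" where
  "volterra_solution b F X \<longleftrightarrow>
     continuous_on {0..} X \<and>
     (\<forall>t\<ge>0. \<forall>k. X t $ k = (\<Sum>l\<in>UNIV. integral {0..t} (\<lambda>\<tau>. b k l t \<tau> * X \<tau> $ l)) + F t $ k)"

definition deriv_nonneg :: "(real \<Rightarrow> real ^ 'n) \<Rightarrow> real \<Rightarrow> real ^ 'n" where
  "deriv_nonneg F t = vector_derivative F (at t within {0..})"

text \<open>
  Continuously differentiable perturbations with \<open>sup \<parallel>F'\<parallel> \<le> d1\<close> and \<open>\<parallel>F 0\<parallel> \<le> d2\<close>. Every solution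
  \<open>X\<close> of the perturbed system has \<open>X 0 = F 0\<close>.
\<close>

definition perturbation :: "real \<Rightarrow> real \<Rightarrow> (real \<Rightarrow> real ^ 'n) \<Rightarrow> bool" where
  "perturbation d1 d2 F \<longleftrightarrow>
     F differentiable_on {0..} \<and> continuous_on {0..} (deriv_nonneg F) \<and>
     (\<forall>t\<ge>0. infnorm (deriv_nonneg F t) \<le> d1) \<and> infnorm (F 0) \<le> d2"

definition trivial_solution_stable :: "('n::finite \<Rightarrow> 'n \<Rightarrow> real \<Rightarrow> real \<Rightarrow> real) \<Rightarrow> bool" where
  "trivial_solution_stable b \<longleftrightarrow>
     (\<forall>\<epsilon>>0. \<exists>d1>0. \<exists>d2>0. d2 \<le> \<epsilon> \<and>
        (\<forall>F X. perturbation d1 d2 F \<longrightarrow> volterra_solution b F X \<longrightarrow> (\<forall>t\<ge>0. infnorm (X t) \<le> \<epsilon>)))"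

definition phi_star ::
    "('n \<Rightarrow> 'n \<Rightarrow> real \<Rightarrow> real \<Rightarrow> real) \<Rightarrow> (real \<Rightarrow> real ^ 'n) \<Rightarrow> real \<Rightarrow> real \<Rightarrow> real" where
  "phi_star b F \<epsilon> s =
     integral {0..s} (\<lambda>\<tau>. op_infnorm (kernel_deriv b s \<tau>)) + infnorm (deriv_nonneg F s) / \<epsilon>"

definition stability_condition ::
    "('n \<Rightarrow> 'n \<Rightarrow> real \<Rightarrow> real \<Rightarrow> real) \<Rightarrow> (real \<Rightarrow> real ^ 'n) \<Rightarrow> real \<Rightarrow> bool" where
  "stability_condition b F \<epsilon> \<longleftrightarrow>
     (\<forall>t' t. 0 \<le> t' \<longrightarrow> t' < t \<longrightarrow>
        log_norm (kernel_diag b t) + 1 / (t - t') * integral {t'..t} (phi_star b F \<epsilon>) < 0)"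

end

theory Submission
  imports Defs
begin

text \<open>
  By Fubini and the fundamental theorem of calculus, the integral equation can be differentiated almost
  everywhere: \<open>X' = B X + \<integral> C X + F'\<close>, although the kernel is merely differentiable in the
  first variable. Letting \<open>t' \<rightarrow> t\<close> in the stability condition, Lebesgue's differentiation theorem
  yields \<open>\<Lambda>(B(t)) + \<phi>\<^sup>*(t) \<le> 0\<close> for almost all \<open>t\<close>.

  Suppose that \<open>\<parallel>X\<parallel>\<close> attains its maximum \<open>M > \<epsilon>\<close> over \<open>[0, T]\<close> at time \<open>t\<close> in the component \<open>k\<close>, with
  sign \<open>\<sigma>\<close>. On \<open>[0, t]\<close> the function \<open>u = M - \<sigma> x\<^sub>k\<close> is nonnegative, and bounding all other
  components by \<open>M\<close> gives \<open>u' \<ge> - \<bar>b\<^sub>k\<^sub>k\<bar> u - (\<Lambda>(B) + \<phi>\<^sup>*) M \<ge> - \<bar>b\<^sub>k\<^sub>k\<bar> u\<close> almost everywhere. As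
  \<open>u(0) \<ge> M - \<epsilon> > 0\<close>, this keeps \<open>u\<close> positive, contradicting \<open>u(t) = 0\<close>.
\<close>

section \<open>Operator norm and logarithmic norm for the max-norm\<close>

lemma infnorm_cart_le_iff: "infnorm (x :: real ^ 'n) \<le> M \<longleftrightarrow> (\<forall>i. \<bar>x $ i\<bar> \<le> M)"
proof
  assume "\<forall>i. \<bar>x $ i\<bar> \<le> M"
  then show "infnorm x \<le> M"
    unfolding infnorm_cart by (intro cSup_least) auto
qed (meson component_le_infnorm_cart order_trans)

lemma infnorm_cart_attained: "\<exists>k. infnorm (x :: real ^ 'n) = \<bar>x $ k\<bar>"
proof -
  have "Max (range (\<lambda>k. \<bar>x $ k\<bar>)) \<in> range (\<lambda>k. \<bar>x $ k\<bar>)"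
    by (rule Max_in) auto
  moreover have "infnorm x = Max (range (\<lambda>k. \<bar>x $ k\<bar>))"
    unfolding infnorm_cart by (subst cSup_eq_Max[symmetric]) (auto simp: full_SetCompr_eq)
  ultimately show ?thesis
    by (simp add: image_iff)
qed

definition row_sum :: "real ^ 'n ^ 'n \<Rightarrow> 'n \<Rightarrow> real" where
  "row_sum A i = (\<Sum>j\<in>UNIV. \<bar>A $ i $ j\<bar>)"

text \<open>The triangle inequality bounds each quotient by the largest absolute row sum; the sign
  vector of a maximal row attains it.\<close>

lemma op_infnorm_eq_Max: "op_infnorm (A :: real ^ 'n ^ 'n) = Max (range (row_sum A))"
proof -
  have "Max (range (row_sum A)) \<in> range (row_sum A)"
    by (rule Max_in) auto
  then obtain i where i: "Max (range (row_sum A)) = row_sum A i"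
    by blast
  have row_le: "row_sum A k \<le> row_sum A i" for k
    unfolding i[symmetric] by (rule Max_ge) auto
  have nonneg: "0 \<le> row_sum A i"
    by (simp add: row_sum_def sum_nonneg)
  have upper: "infnorm (A *v x) / infnorm x \<le> row_sum A i" for x
  \<comment> \<open>The supremum also ranges over \<open>x = 0\<close>, where the quotient is
    \<open>0 / 0 = 0\<close>; nonnegativity of row sums covers this value.\<close>
  proof (cases "x = 0")
    case False
    have "\<bar>(A *v x) $ k\<bar> \<le> row_sum A i * infnorm x" for k
    proof -
      have "\<bar>(A *v x) $ k\<bar> \<le> (\<Sum>j\<in>UNIV. \<bar>A $ k $ j * x $ j\<bar>)"
        unfolding matrix_vector_mult_def by (simp add: sum_abs)
      also have "\<dots> \<le> (\<Sum>j\<in>UNIV. \<bar>A $ k $ j\<bar> * infnorm x)"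
        by (intro sum_mono) (simp add: abs_mult mult_left_mono component_le_infnorm_cart)
      also have "\<dots> = row_sum A k * infnorm x"
        by (simp add: row_sum_def sum_distrib_right)
      also have "\<dots> \<le> row_sum A i * infnorm x"
        by (intro mult_right_mono row_le infnorm_pos_le)
      finally show ?thesis .
    qed
    then have "infnorm (A *v x) \<le> row_sum A i * infnorm x"
      by (simp add: infnorm_cart_le_iff)
    with False show ?thesis
      by (simp add: divide_le_eq infnorm_pos_lt)
  qed (simp add: nonneg infnorm_0)
  define x :: "real ^ 'n" where "x = (\<chi> j. if 0 \<le> A $ i $ j then 1 else - 1)"
  have x1: "infnorm x = 1"
    by (intro antisym) (use component_le_infnorm_cart[of x i] in
        \<open>auto simp: infnorm_cart_le_iff x_def split: if_splits\<close>)
  have "(A *v x) $ i = row_sum A i"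
    unfolding matrix_vector_mult_def row_sum_def x_def
    by (auto intro!: sum.cong)
  then have "row_sum A i \<le> infnorm (A *v x) / infnorm x"
    using component_le_infnorm_cart[of "A *v x" i] x1 by auto
  also have "\<dots> \<le> op_infnorm A"
    unfolding op_infnorm_def by (intro cSUP_upper) (use upper in \<open>auto intro!: bdd_aboveI2\<close>)
  finally have "row_sum A i \<le> op_infnorm A" .
  moreover have "op_infnorm A \<le> row_sum A i"
    unfolding op_infnorm_def by (intro cSUP_least upper) auto
  ultimately show ?thesis
    using i by simp
qed

lemma row_sum_le_op_infnorm: "(\<Sum>j\<in>UNIV. \<bar>A $ i $ j\<bar>) \<le> op_infnorm A"
  unfolding op_infnorm_eq_Max by (rule Max_ge) (auto simp: row_sum_def)

lemma component_le_op_infnorm: "\<bar>A $ i $ j\<bar> \<le> op_infnorm A"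
proof -
  have "\<bar>A $ i $ j\<bar> \<le> (\<Sum>j\<in>UNIV. \<bar>A $ i $ j\<bar>)"
    by (rule member_le_sum) auto
  then show ?thesis
    using row_sum_le_op_infnorm[of A i] by simp
qed

text \<open>For the memory term the plain operator norm suffices, so no sign of a diagonal entry has
  to be tracked.\<close>

lemma abs_matrix_row_le:
  fixes A :: "real ^ 'n ^ 'n"
  assumes "infnorm x \<le> M"
  shows "\<bar>\<Sum>l\<in>UNIV. A $ k $ l * x $ l\<bar> \<le> op_infnorm A * M"
proof -
  have "0 \<le> M"
    using assms infnorm_pos_le[of x] by linarith
  have "\<bar>\<Sum>l\<in>UNIV. A $ k $ l * x $ l\<bar> \<le> (\<Sum>l\<in>UNIV. \<bar>A $ k $ l * x $ l\<bar>)"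
    by (rule sum_abs)
  also have "\<dots> \<le> (\<Sum>l\<in>UNIV. \<bar>A $ k $ l\<bar> * M)"
    using assms by (intro sum_mono) (simp add: abs_mult mult_left_mono infnorm_cart_le_iff)
  also have "\<dots> \<le> op_infnorm A * M"
    using \<open>0 \<le> M\<close> by (simp add: sum_distrib_right[symmetric] mult_right_mono row_sum_le_op_infnorm)
  finally show ?thesis .
qed

section \<open>The logarithmic norm in closed form\<close>

definition log_row :: "real ^ 'n ^ 'n \<Rightarrow> 'n \<Rightarrow> real" where
  "log_row A i = A $ i $ i + (\<Sum>j\<in>UNIV - {i}. \<bar>A $ i $ j\<bar>)"

text \<open>For small \<open>h\<close> all diagonal entries of \<open>I + hA\<close> are
  nonnegative, so their absolute values open and the row sums are affine in \<open>h\<close>. The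
  difference quotient is then constant, and its limit is immediate.\<close>

lemma log_norm_eq_Max: "log_norm A = Max (range (log_row A))"
proof -
  define m where "m = Max (range (\<lambda>i. \<bar>A $ i $ i\<bar>))"
  have m: "\<bar>A $ i $ i\<bar> \<le> m" for i
    unfolding m_def by (rule Max_ge) auto
  have m0: "0 \<le> m"
    using m[of undefined] by linarith
  \<comment> \<open>The \<open>+ 1\<close> keeps the threshold meaningful when the whole diagonal of
    \<open>A\<close> vanishes.\<close>
  have eq: "(op_infnorm (mat 1 + h *\<^sub>R A) - 1) / h = Max (range (log_row A))"
    if h: "0 < h" "h < 1 / (m + 1)" for h
  proof -
    have "row_sum (mat 1 + h *\<^sub>R A) i = 1 + h * log_row A i" for i
    proof -
      have "h * \<bar>A $ i $ i\<bar> \<le> h * (m + 1)"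
        using m[of i] h by (intro mult_left_mono) auto
      also have "\<dots> \<le> 1"
        using h m0 by (simp add: field_simps)
      finally have "0 \<le> 1 + h * A $ i $ i"
        using mult_left_mono[OF abs_ge_minus_self[of "A $ i $ i"], of h] h by simp
      then show ?thesis
        using h unfolding row_sum_def log_row_def
        by (subst sum.remove[of _ i])
           (auto simp: mat_def abs_mult sum_distrib_left algebra_simps intro!: sum.cong)
    qed
    then have "range (row_sum (mat 1 + h *\<^sub>R A)) = (\<lambda>y. 1 + h * y) ` range (log_row A)"
      by (simp add: image_image)
    \<comment> \<open>The map \<open>y \<mapsto> 1 + h * y\<close> is monotone and hence commutes
      with \<open>Max\<close>.\<close>
    moreover have "1 + h * Max (range (log_row A)) = Max ((\<lambda>y. 1 + h * y) ` range (log_row A))"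
      using h by (intro mono_Max_commute) (auto intro!: monoI mult_left_mono)
    ultimately have "op_infnorm (mat 1 + h *\<^sub>R A) = 1 + h * Max (range (log_row A))"
      unfolding op_infnorm_eq_Max by simp
    then show ?thesis
      using h by simp
  qed
  have "eventually (\<lambda>h. h < 1 / (m + 1)) (at_right 0)"
    using m0 by (intro order_tendstoD[OF tendsto_ident_at]) auto
  then have "eventually (\<lambda>h. Max (range (log_row A)) = (op_infnorm (mat 1 + h *\<^sub>R A) - 1) / h) (at_right 0)"
    using eventually_at_right_less[of "0::real"]
    by eventually_elim (use eq in auto)
  then have "((\<lambda>h. (op_infnorm (mat 1 + h *\<^sub>R A) - 1) / h) \<longlongrightarrow> Max (range (log_row A))) (at_right 0)"
    by (rule Lim_transform_eventually[OF tendsto_const])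
  then show ?thesis
    unfolding log_norm_def by (intro tendsto_Lim) auto
qed

lemma log_row_le_log_norm: "A $ i $ i + (\<Sum>j\<in>UNIV - {i}. \<bar>A $ i $ j\<bar>) \<le> log_norm A"
  unfolding log_norm_eq_Max by (rule Max_ge) (auto simp: log_row_def)

text \<open>Off-diagonal terms are at most \<open>\<bar>A $ k $ l\<bar> * M\<close>. In the diagonal
  term, \<open>\<sigma> * x $ k\<close> is written as \<open>M\<close> minus the gap
  \<open>M - \<sigma> * x $ k\<close>, so the cost of not being at the maximum is linear in this
  gap.\<close>

lemma matrix_row_le_log_norm:
  fixes A :: "real ^ 'n ^ 'n"
  assumes "infnorm x \<le> M" and \<sigma>: "\<bar>\<sigma>\<bar> = 1"
  shows "\<sigma> * (\<Sum>l\<in>UNIV. A $ k $ l * x $ l) \<le> log_norm A * M + \<bar>A $ k $ k\<bar> * (M - \<sigma> * x $ k)"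
proof -
  have "0 \<le> M"
    using assms infnorm_pos_le[of x] by linarith
  have x: "\<bar>x $ l\<bar> \<le> M" for l
    using assms by (simp add: infnorm_cart_le_iff)
  have "\<sigma> * (A $ k $ l * x $ l) \<le> \<bar>A $ k $ l\<bar> * M" for l
  proof -
    have "\<sigma> * (A $ k $ l * x $ l) \<le> \<bar>A $ k $ l\<bar> * \<bar>x $ l\<bar>"
      using abs_ge_self[of "\<sigma> * (A $ k $ l * x $ l)"] \<sigma> by (simp add: abs_mult)
    also have "\<dots> \<le> \<bar>A $ k $ l\<bar> * M"
      by (intro mult_left_mono x) auto
    finally show ?thesis .
  qed
  then have "\<sigma> * (\<Sum>l\<in>UNIV - {k}. A $ k $ l * x $ l) \<le> (\<Sum>l\<in>UNIV - {k}. \<bar>A $ k $ l\<bar>) * M"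
    by (simp add: sum_distrib_left sum_distrib_right sum_mono)
  moreover have "(A $ k $ k + (\<Sum>l\<in>UNIV - {k}. \<bar>A $ k $ l\<bar>)) * M \<le> log_norm A * M"
    by (intro mult_right_mono log_row_le_log_norm \<open>0 \<le> M\<close>)
  moreover have "- A $ k $ k * (M - \<sigma> * x $ k) \<le> \<bar>A $ k $ k\<bar> * (M - \<sigma> * x $ k)"
    using abs_le_D1[of "\<sigma> * x $ k" M] x[of k] \<sigma> by (intro mult_right_mono) (auto simp: abs_mult)
  ultimately show ?thesis
    by (subst sum.remove[of _ k]) (auto simp: algebra_simps)
qed

section \<open>Real integrals\<close>

text \<open>As \<open>s\<close> tends to \<open>t\<close> from the left, the averages tend to
  \<open>\<phi> t\<close> for almost every \<open>t\<close>. The term \<open>L t\<close> stays fixed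
  meanwhile, so \<open>L\<close> may be an arbitrary function.\<close>

lemma AE_left_average_le:
  fixes \<phi> :: "real \<Rightarrow> real"
  assumes "\<And>T. 0 \<le> T \<Longrightarrow> \<phi> integrable_on {0..T}"
    and bound: "\<And>s t. 0 \<le> s \<Longrightarrow> s < t \<Longrightarrow> L t + 1 / (t - s) * integral {s..t} \<phi> \<le> 0"
  shows "AE t in lebesgue. 0 < t \<longrightarrow> L t + \<phi> t \<le> 0"
proof -
  \<comment> \<open>Reflection turns left averages of \<open>\<phi>\<close> into right averages of
    \<open>g\<close>; the cut-off at 0 makes \<open>g\<close> integrable on every interval.\<close>
  define g where "g = (\<lambda>x. if x \<in> {..0} then \<phi> (- x) else 0)"
  have g: "g integrable_on cbox a b" for a b
  proof -
    have "\<phi> integrable_on {0..\<bar>a\<bar>}"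
      using assms(1) by auto
    then have "(\<lambda>x. \<phi> (- x)) integrable_on {- \<bar>a\<bar>..0}"
      using Henstock_Kurzweil_Integration.integrable_reflect_real[of \<phi> "\<bar>a\<bar>" 0] by simp
    then have "(\<lambda>x. \<phi> (- x)) integrable_on {a..min b 0}"
      by (rule integrable_on_subinterval) auto
    then show ?thesis
      unfolding g_def by (subst integrable_restrict_Int) (simp add: Int_atMost min.commute)
  qed
  obtain N where N: "negligible N"
    "\<And>x e. x \<notin> N \<Longrightarrow> 0 < e \<Longrightarrow> \<exists>d>0. \<forall>h. 0 < h \<and> h < d \<longrightarrow>
        norm (integral (cbox x (x + h *\<^sub>R One)) g /\<^sub>R h ^ DIM(real) - g x) < e"
    using integrable_ccontinuous_explicit[OF g] by blast
  have "L t + \<phi> t \<le> 0" if t: "- t \<notin> N" "0 < t" for t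
  proof (rule field_le_epsilon)
    fix e :: real assume "0 < e"
    then obtain d where d: "d > 0" "\<And>h. 0 < h \<Longrightarrow> h < d \<Longrightarrow>
        norm (integral (cbox (- t) (- t + h *\<^sub>R One)) g /\<^sub>R h ^ DIM(real) - g (- t)) < e"
      using N(2)[OF t(1)] by blast
    \<comment> \<open>The bound by \<open>t\<close> keeps the averaging interval
      \<open>{t - h..t}\<close> inside \<open>{0..}\<close>.\<close>
    define h where "h = min (d / 2) t"
    have h: "0 < h" "h < d" "h \<le> t"
      using d t by (auto simp: h_def)
    have "{- t..- t + h} = {- t..- (t - h)}"
      by simp
    then have "integral {- t..- t + h} g = integral {- t..- (t - h)} (\<lambda>x. \<phi> (- x))"
      using h by (auto simp: g_def intro!: integral_cong)
    also have "\<dots> = integral {t - h..t} \<phi>"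
      by (rule Henstock_Kurzweil_Integration.integral_reflect_real)
    finally have "\<bar>integral {t - h..t} \<phi> / h - \<phi> t\<bar> < e"
      using d(2)[OF h(1,2)] t(2) by (simp add: g_def divide_inverse mult.commute)
    moreover have "L t + integral {t - h..t} \<phi> / h \<le> 0"
      using bound[of "t - h" t] h by simp
    ultimately show "L t + \<phi> t \<le> 0 + e"
      by linarith
  qed
  moreover have "AE t in lebesgue. - t \<notin> N"
  proof -
    \<comment> \<open>The exceptional set for \<open>\<phi>\<close> is the mirror image of
      \<open>N\<close>, again a null set.\<close>
    have "negligible (uminus ` N)"
      by (intro negligible_differentiable_image_negligible N(1)) (auto intro!: derivative_intros simp: differentiable_on_def)
    then have "AE t in lebesgue. t \<notin> uminus ` N"
      by (simp add: AE_not_in negligible_iff_null_sets)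
    then show ?thesis
      by eventually_elim force
  qed
  ultimately show ?thesis
    by (auto elim: eventually_mono)
qed

text \<open>If \<open>u\<close> first vanishes at \<open>\<tau>\<close>, then on a left neighbourhood of \<open>\<tau>\<close> where \<open>\<beta>\<close> has integral at most
  \<open>1/2\<close>, \<open>u\<close> cannot lose more than half of its maximum there.\<close>

lemma positive_if_integral_decay:
  fixes u \<beta> :: "real \<Rightarrow> real"
  assumes u: "continuous_on {0..T} u" and u0: "0 < u 0" and nonneg: "\<And>t. t \<in> {0..T} \<Longrightarrow> 0 \<le> u t"
    and \<beta>: "\<beta> integrable_on {0..T}" "\<And>t. t \<in> {0..T} \<Longrightarrow> 0 \<le> \<beta> t"
    and \<beta>u: "(\<lambda>r. \<beta> r * u r) integrable_on {0..T}"
    and decay: "\<And>s t. 0 \<le> s \<Longrightarrow> s \<le> t \<Longrightarrow> t \<le> T \<Longrightarrow> u s - integral {s..t} (\<lambda>r. \<beta> r * u r) \<le> u t"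
    and t: "t \<in> {0..T}"
  shows "0 < u t"
proof (rule ccontr)
  assume "\<not> 0 < u t"
  \<comment> \<open>The zero set is closed, so it has a least element, the first zero of
    \<open>u\<close>.\<close>
  define Z where "Z = {r \<in> {0..T}. u r = 0}"
  have "closed Z"
    unfolding Z_def using continuous_closed_preimage_constant[OF u] by simp
  moreover have "t \<in> Z" "bdd_below Z"
    using \<open>\<not> 0 < u t\<close> nonneg[OF t] t by (auto simp: Z_def intro!: bdd_belowI[of _ 0])
  ultimately have \<tau>: "Inf Z \<in> Z"
    by (intro closed_contains_Inf) auto
  define \<tau> where "\<tau> = Inf Z"
  have "0 \<le> \<tau>" "\<tau> \<le> T" "u \<tau> = 0"
    using \<tau> by (auto simp: \<tau>_def Z_def)
  with u0 have "0 < \<tau>"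
    by (metis less_eq_real_def order_less_irrefl)
  have pos: "0 < u r" if "0 \<le> r" "r < \<tau>" for r
  proof -
    have "r \<notin> Z"
      using cInf_lower[OF _ \<open>bdd_below Z\<close>, of r] that by (auto simp: \<tau>_def)
    with nonneg[of r] that \<open>\<tau> \<le> T\<close> show ?thesis
      by (force simp: Z_def)
  qed
  have "continuous_on {0..\<tau>} (\<lambda>s. integral {s..\<tau>} \<beta>)"
    by (intro indefinite_integral_continuous_1' integrable_on_subinterval[OF \<beta>(1)])
       (use \<open>\<tau> \<le> T\<close> in auto)
  then obtain d where d: "0 < d" "\<And>s. s \<in> {0..\<tau>} \<Longrightarrow> dist s \<tau> < d \<Longrightarrow> dist (integral {s..\<tau>} \<beta>) (integral {\<tau>..\<tau>} \<beta>) < 1 / 2"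
    using \<open>0 < \<tau>\<close> unfolding continuous_on_iff
    by (metis atLeastAtMost_iff less_eq_real_def zero_less_divide_1_iff zero_less_numeral)
  define s where "s = max 0 (\<tau> - d / 2)"
  have s: "0 \<le> s" "s < \<tau>" "\<bar>integral {s..\<tau>} \<beta>\<bar> < 1 / 2"
    using d(2)[of s] d(1) \<open>0 < \<tau>\<close> by (auto simp: s_def dist_real_def split: split_max)
  have "continuous_on {s..\<tau>} u"
    using s \<open>\<tau> \<le> T\<close> by (intro continuous_on_subset[OF u]) auto
  \<comment> \<open>Starting the decay estimate at a maximiser \<open>r\<close> allows
    \<open>u\<close> to be replaced by \<open>u r\<close> under the integral, which gives
    \<open>u \<tau> \<ge> u r / 2 > 0\<close>.\<close>
  then obtain r where r: "r \<in> {s..\<tau>}" "\<And>q. q \<in> {s..\<tau>} \<Longrightarrow> u q \<le> u r"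
    using continuous_attains_sup[of "{s..\<tau>}" u] s by auto
  have "0 < u r"
    using pos[of s] s r(2)[of s] by auto
  have sub: "{r..\<tau>} \<subseteq> {0..T}" "{s..\<tau>} \<subseteq> {0..T}"
    using r s \<open>\<tau> \<le> T\<close> by auto
  note int = integrable_on_subinterval[OF \<beta>(1) sub(1)] integrable_on_subinterval[OF \<beta>(1) sub(2)]
  have "integral {r..\<tau>} (\<lambda>q. \<beta> q * u q) \<le> integral {r..\<tau>} (\<lambda>q. \<beta> q * u r)"
    using r sub
    by (intro integral_le integrable_on_subinterval[OF \<beta>u] integrable_on_mult_left int mult_left_mono \<beta>) auto
  also have "\<dots> = integral {r..\<tau>} \<beta> * u r"
    by simp
  also have "\<dots> \<le> integral {s..\<tau>} \<beta> * u r"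
    using r sub \<open>0 < u r\<close> by (intro mult_right_mono integral_subset_le int) (auto intro: \<beta>(2))
  also have "\<dots> \<le> 1 / 2 * u r"
    using s \<open>0 < u r\<close> by (intro mult_right_mono) auto
  finally show False
    using decay[of r \<tau>] r s \<open>\<tau> \<le> T\<close> \<open>u \<tau> = 0\<close> \<open>0 < u r\<close> by auto
qed

text \<open>Replacing \<open>f\<close> by \<open>g\<close> on the exceptional null set does not
  change the integral and makes the inequality pointwise on \<open>S\<close>.\<close>

lemma integral_le_AE:
  fixes f g :: "real \<Rightarrow> real"
  assumes f: "f integrable_on S" and g: "g integrable_on S" and le: "AE x in lebesgue. x \<in> S \<longrightarrow> f x \<le> g x"
  shows "integral S f \<le> integral S g"
proof -
  obtain N where N: "negligible N" "{x. \<not> (x \<in> S \<longrightarrow> f x \<le> g x)} \<subseteq> N"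
    using le unfolding eventually_ae_filter_negligible by blast
  define f' where "f' x = (if x \<in> N then g x else f x)" for x
  have "integral S f = integral S f'"
    by (rule integral_spike[OF N(1)]) (simp add: f'_def)
  also have "\<dots> \<le> integral S g"
    by (intro integral_le integrable_spike[OF f N(1)] g) (use N(2) in \<open>auto simp: f'_def\<close>)
  finally show ?thesis .
qed

text \<open>On the compact interval \<open>y\<close> is bounded and measurable.\<close>

lemma times_continuous_absolutely_integrable:
  fixes f y :: "real \<Rightarrow> real"
  assumes "f absolutely_integrable_on {0..T}" "continuous_on {0..} y"
  shows "(\<lambda>\<tau>. f \<tau> * y \<tau>) absolutely_integrable_on {0..T}"
proof -
  have y: "continuous_on {0..T} y"
    by (rule continuous_on_subset[OF assms(2)]) auto
  then have "(\<lambda>\<tau>. y \<tau> * f \<tau>) absolutely_integrable_on {0..T}"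
    by (intro absolutely_integrable_bounded_measurable_product_real assms(1)
          continuous_imp_measurable_on_sets_lebesgue compact_imp_bounded compact_continuous_image) auto
  then show ?thesis
    by (simp add: mult.commute)
qed

section \<open>Kernels differentiable in the first variable\<close>

text \<open>Balls of natural radius cover the space. This is what Fubini's theorem needs with
  \<open>lebesgue\<close> as a factor.\<close>

lemma sigma_finite_lebesgue: "sigma_finite_measure (lebesgue :: 'a::euclidean_space measure)"
proof
  define \<A> where "\<A> = range (\<lambda>n::nat. cball (0::'a) (real n))"
  have "countable \<A>" "\<A> \<subseteq> sets lebesgue" "\<forall>A\<in>\<A>. emeasure lebesgue A \<noteq> \<infinity>"
    using emeasure_bounded_finite[OF bounded_cball] by (auto simp: \<A>_def less_top[symmetric])
  moreover have "\<Union>\<A> = UNIV"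
    by (auto simp: \<A>_def intro: real_arch_simple)
  ultimately show "\<exists>\<A>. countable \<A> \<and> \<A> \<subseteq> sets (lebesgue :: 'a measure) \<and> \<Union>\<A> = space lebesgue \<and>
      (\<forall>A\<in>\<A>. emeasure lebesgue A \<noteq> \<infinity>)"
    by (intro exI[of _ \<A>]) simp
qed

text \<open>The factors differ on purpose: in \<open>\<tau>\<close> kernels are only Lebesgue
  measurable, while in \<open>s\<close> differentiability makes Borel sets sufficient.\<close>

interpretation lborel_lebesgue: pair_sigma_finite lborel "lebesgue :: real measure"
  by (intro pair_sigma_finite.intro sigma_finite_lborel sigma_finite_lebesgue)

lemma snd_measurable_lborel_lebesgue [measurable]:
  "snd \<in> borel_measurable (lborel \<Otimes>\<^sub>M (lebesgue :: real measure))"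
proof -
  have "(\<lambda>x::real. x) \<in> borel_measurable lebesgue"
    by (rule measurable_completion) simp
  then show ?thesis
    by (rule measurable_compose[OF measurable_snd])
qed

text \<open>One scalar entry of a kernel: \<open>c\<close> is its derivative and \<open>N\<close> an
  integrable majorant, later the operator norm of the whole derivative matrix. Measurability of
  \<open>c\<close> and of the diagonal is derived, not assumed.\<close>

locale differentiable_kernel =
  fixes a c N :: "real \<Rightarrow> real \<Rightarrow> real"
  assumes deriv: "\<And>\<tau> t. 0 \<le> \<tau> \<Longrightarrow> \<tau> \<le> t \<Longrightarrow> ((\<lambda>s. a s \<tau>) has_vector_derivative c t \<tau>) (at t within {\<tau>..})"
    and kernel_integrable: "\<And>t. 0 \<le> t \<Longrightarrow> a t absolutely_integrable_on {0..t}"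
    and deriv_bound: "\<And>s \<tau>. \<bar>c s \<tau>\<bar> \<le> N s \<tau>"
    and bound_integrable: "\<And>s. 0 \<le> s \<Longrightarrow> N s integrable_on {0..s}"
    and bound_integral_integrable: "\<And>T. 0 \<le> T \<Longrightarrow> (\<lambda>s. integral {0..s} (N s)) integrable_on {0..T}"
begin

definition kernel_ext :: "real \<Rightarrow> real \<Rightarrow> real" where
  "kernel_ext s \<tau> = indicator {0..s} \<tau> * a s \<tau>"

lemma kernel_ext_measurable [measurable]: "kernel_ext s \<in> borel_measurable lebesgue"
proof (cases "0 \<le> s")
  case True
  then show ?thesis
    using kernel_integrable[OF True] by (auto simp: set_integrable_def kernel_ext_def[abs_def])
qed (simp add: kernel_ext_def[abs_def])

text \<open>A function measurable in \<open>\<tau>\<close> and right continuous in \<open>s\<close> is jointly measurable: replace \<open>s\<close> by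
  the next multiple of \<open>1/(n+1)\<close> and let \<open>n\<close> tend to infinity. Rounding upwards stays in the triangle
  where \<open>a\<close> is controlled.\<close>

lemma kernel_ext_measurable_pair: "(\<lambda>(s, \<tau>). kernel_ext s \<tau>) \<in> borel_measurable (lborel \<Otimes>\<^sub>M lebesgue)"
proof (rule borel_measurable_LIMSEQ_real)
  define q where "q = (\<lambda>n s. real_of_int \<lceil>real (Suc n) * s\<rceil> / real (Suc n))"
  \<comment> \<open>The triangle test uses \<open>s\<close> itself rather than \<open>q n s\<close>,
    so \<open>f n\<close> vanishes outside the triangle for every \<open>n\<close>.\<close>
  define f where "f = (\<lambda>n (s, \<tau>). if 0 \<le> \<tau> \<and> \<tau> \<le> s then kernel_ext (q n s) \<tau> else 0)"
  have q_ge: "s \<le> q n s" and q_le: "q n s \<le> s + 1 / real (Suc n)" for n s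
    using of_int_ceiling_le_add_one[of "real (Suc n) * s"] le_of_int_ceiling[of "real (Suc n) * s"]
    by (auto simp: q_def field_simps simp del: of_nat_Suc)
  have q_tendsto: "(\<lambda>n. q n s) \<longlonglongrightarrow> s" for s
  proof (rule tendsto_sandwich[where f = "\<lambda>_. s"])
    show "(\<lambda>n. s + 1 / real (Suc n)) \<longlonglongrightarrow> s"
      using tendsto_add[OF tendsto_const LIMSEQ_inverse_real_of_nat, of s] by (simp add: inverse_eq_divide)
    show "\<forall>\<^sub>F n in sequentially. s \<le> q n s" "\<forall>\<^sub>F n in sequentially. q n s \<le> s + 1 / real (Suc n)"
      by (intro always_eventually allI q_ge q_le)+
  qed auto
  show "f n \<in> borel_measurable (lborel \<Otimes>\<^sub>M lebesgue)" for n
  proof -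
    have "(\<lambda>p::real \<times> real. kernel_ext (real_of_int \<lceil>real (Suc n) * fst p\<rceil> / real (Suc n)) (snd p))
        \<in> borel_measurable (lborel \<Otimes>\<^sub>M lebesgue)"
    \<comment> \<open>The ceiling takes countably many values, and for each of them only
      measurability in \<open>\<tau>\<close> is involved.\<close>
    proof (rule measurable_compose_countable[where f = "\<lambda>i p. kernel_ext (real_of_int i / real (Suc n)) (snd p)"])
      show "(\<lambda>p. kernel_ext (real_of_int i / real (Suc n)) (snd p)) \<in> borel_measurable (lborel \<Otimes>\<^sub>M lebesgue)" for i
        by (rule measurable_compose[OF measurable_snd kernel_ext_measurable])
      show "(\<lambda>p::real \<times> real. \<lceil>real (Suc n) * fst p\<rceil>) \<in> lborel \<Otimes>\<^sub>M lebesgue \<rightarrow>\<^sub>M count_space UNIV"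
        by measurable
    qed
    then show ?thesis
      unfolding f_def q_def case_prod_beta' by measurable
  qed
  show "(\<lambda>n. f n p) \<longlonglongrightarrow> (case p of (s, \<tau>) \<Rightarrow> kernel_ext s \<tau>)" for p
  proof (cases p)
    case (Pair s \<tau>)
    show ?thesis
    proof (cases "0 \<le> \<tau> \<and> \<tau> \<le> s")
      case True
      have "((\<lambda>s. a s \<tau>) \<longlongrightarrow> a s \<tau>) (at s within {\<tau>..})"
        using has_vector_derivative_continuous[OF deriv[of \<tau> s]] True by (simp add: continuous_within)
      then have "(\<lambda>n. a (q n s) \<tau>) \<longlonglongrightarrow> a s \<tau>"
        using continuous_within_tendsto_compose'[of s "{\<tau>..}" "\<lambda>s. a s \<tau>" "\<lambda>n. q n s", OF _ _ q_tendsto] True q_ge[of s]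
        by (auto simp: continuous_within intro: order_trans)
      moreover have "f n p = a (q n s) \<tau>" for n
        using True q_ge[of s n] Pair by (auto simp: f_def kernel_ext_def)
      ultimately show ?thesis
        using True Pair by (simp add: kernel_ext_def)
    qed (auto simp: f_def kernel_ext_def Pair)
  qed
qed

text \<open>The derivative is a pointwise limit of jointly measurable difference quotients. The
  steps go forward, since \<open>s + h n\<close> then stays in the triangle.\<close>

lemma deriv_measurable_pair:
  "(\<lambda>(s, \<tau>). indicator {0..s} \<tau> * c s \<tau>) \<in> borel_measurable (lborel \<Otimes>\<^sub>M lebesgue)"
proof (rule borel_measurable_LIMSEQ_real)
  define h where "h = (\<lambda>n. 1 / real (Suc n))"
  have h: "0 < h n" for n
    by (simp add: h_def)
  define f where "f = (\<lambda>n (s, \<tau>). if 0 \<le> \<tau> \<and> \<tau> \<le> s then (kernel_ext (s + h n) \<tau> - kernel_ext s \<tau>) / h n else 0)"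
  show "f n \<in> borel_measurable (lborel \<Otimes>\<^sub>M lebesgue)" for n
  proof -
    have "(\<lambda>p::real \<times> real. (fst p + h n, snd p)) \<in> lborel \<Otimes>\<^sub>M lebesgue \<rightarrow>\<^sub>M lborel \<Otimes>\<^sub>M lebesgue"
      by measurable
    from measurable_compose[OF this kernel_ext_measurable_pair] kernel_ext_measurable_pair
    show ?thesis
      unfolding f_def case_prod_beta' by simp
  qed
  have h_tendsto: "(\<lambda>n. s + h n) \<longlonglongrightarrow> s" for s
    using tendsto_add[OF tendsto_const LIMSEQ_inverse_real_of_nat, of s] by (simp add: inverse_eq_divide h_def)
  show "(\<lambda>n. f n p) \<longlonglongrightarrow> (case p of (s, \<tau>) \<Rightarrow> indicator {0..s} \<tau> * c s \<tau>)" for p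
  proof (cases p)
    case (Pair s \<tau>)
    show ?thesis
    proof (cases "0 \<le> \<tau> \<and> \<tau> \<le> s")
      case True
      have "((\<lambda>y. (a y \<tau> - a s \<tau>) / (y - s)) \<longlongrightarrow> c s \<tau>) (at s within {\<tau>..})"
        using deriv[of \<tau> s] True
        by (simp add: has_real_derivative_iff_has_vector_derivative[symmetric] has_field_derivative_iff)
      moreover have "filterlim (\<lambda>n. s + h n) (at s within {\<tau>..}) sequentially"
        unfolding filterlim_at using h_tendsto h True
        by (auto intro!: always_eventually intro: add_increasing2 less_imp_le simp: less_imp_neq[OF h, symmetric])
      ultimately have "(\<lambda>n. (a (s + h n) \<tau> - a s \<tau>) / (s + h n - s)) \<longlonglongrightarrow> c s \<tau>"
        by (rule filterlim_compose)
      moreover have "f n p = (a (s + h n) \<tau> - a s \<tau>) / (s + h n - s)" for n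
        using True h[of n] Pair by (auto simp: f_def kernel_ext_def)
      ultimately show ?thesis
        using True Pair by simp
    qed (auto simp: f_def Pair)
  qed
qed

lemma deriv_absolutely_integrable:
  assumes "0 \<le> s"
  shows "c s absolutely_integrable_on {0..s}"
proof (rule measurable_bounded_by_integrable_imp_absolutely_integrable)
  have "(\<lambda>\<tau>. indicator {0..s} \<tau> * c s \<tau>) \<in> borel_measurable lebesgue"
    using measurable_compose[OF measurable_Pair1' deriv_measurable_pair, of s] by simp
  then show "c s \<in> borel_measurable (lebesgue_on {0..s})"
    by (subst borel_measurable_restrict_space_iff) auto
qed (use deriv_bound bound_integrable[OF assms] in auto)

lemma deriv_times_absolutely_integrable:
  assumes "0 \<le> s" "continuous_on {0..} y"
  shows "(\<lambda>\<tau>. c s \<tau> * y \<tau>) absolutely_integrable_on {0..s}"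
  by (rule times_continuous_absolutely_integrable[OF deriv_absolutely_integrable[OF assms(1)] assms(2)])

section \<open>Interchanging the order of integration\<close>

definition memory_term :: "(real \<Rightarrow> real) \<Rightarrow> real \<Rightarrow> real" where
  "memory_term y s = integral {0..s} (\<lambda>\<tau>. c s \<tau> * y \<tau>)"

text \<open>Integrate \<open>c s \<tau> * y \<tau>\<close> over the triangle
  \<open>0 \<le> \<tau> \<le> s \<le> T\<close>. Integrating in \<open>\<tau>\<close> first gives
  the memory term; integrating in \<open>s\<close> first gives the increment of \<open>a\<close> by
  the fundamental theorem of calculus.\<close>

lemma fubini_kernel:
  assumes y: "continuous_on {0..} y" and T: "0 \<le> T"
  shows "memory_term y absolutely_integrable_on {0..T}"
    and "(\<lambda>\<tau>. (a T \<tau> - a \<tau> \<tau>) * y \<tau>) absolutely_integrable_on {0..T}"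
    and "integral {0..T} (memory_term y) = integral {0..T} (\<lambda>\<tau>. (a T \<tau> - a \<tau> \<tau>) * y \<tau>)"
proof -
  define G where "G = (\<lambda>s \<tau>. indicator {0..T} s * (indicator {0..s} \<tau> * c s \<tau>) * (indicator {0..} \<tau> * y \<tau>))"
  have [measurable]: "(\<lambda>\<tau>. indicator {0..} \<tau> * y \<tau>) \<in> borel_measurable borel"
    using borel_measurable_continuous_on_indicator[OF _ y] by simp
  have G_meas: "case_prod G \<in> borel_measurable (lborel \<Otimes>\<^sub>M lebesgue)"
  proof -
    have [measurable]: "(\<lambda>p. indicator {0..fst p} (snd p) * c (fst p) (snd p))
        \<in> borel_measurable (lborel \<Otimes>\<^sub>M lebesgue)"
      using deriv_measurable_pair by (simp add: case_prod_beta')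
    show ?thesis
      unfolding G_def case_prod_beta' by measurable
  qed
  have G_eq: "G s \<tau> = indicator {0..T} s * (indicator {0..s} \<tau> *\<^sub>R (c s \<tau> * y \<tau>))" for s \<tau>
    by (auto simp: G_def split: split_indicator)
  have G_int: "integrable lebesgue (G s)" for s
  proof (cases "0 \<le> s")
    case True
    show ?thesis
      using deriv_times_absolutely_integrable[OF True y]
      unfolding set_integrable_def G_eq[abs_def] by (rule integrable_mult_right)
  qed (simp add: G_eq[abs_def])
  have "compact (y ` {0..T})"
    by (intro compact_continuous_image continuous_on_subset[OF y]) auto
  then obtain K where "\<forall>\<tau>\<in>{0..T}. \<bar>y \<tau>\<bar> \<le> K"
    using compact_imp_bounded[of "y ` {0..T}"] by (auto simp: bounded_iff)
  then have K: "\<bar>y \<tau>\<bar> \<le> K" if "\<tau> \<in> {0..T}" for \<tau>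
    using that by blast
  \<comment> \<open>This domination, with \<open>K\<close> bounding \<open>y\<close> on
    \<open>{0..T}\<close>, makes \<open>G\<close> integrable over the product.\<close>
  have G_norm: "(\<integral>\<tau>. norm (G s \<tau>) \<partial>lebesgue) \<le> indicator {0..T} s * (K * integral {0..s} (N s))" for s
  proof (cases "s \<in> {0..T}")
    case True
    have Nabs: "N s absolutely_integrable_on {0..s}"
      using bound_integrable[of s] True deriv_bound[of s]
      by (intro nonnegative_absolutely_integrable_1) (auto intro: order_trans[OF abs_ge_zero])
    have "(\<integral>\<tau>. norm (G s \<tau>) \<partial>lebesgue) \<le> (\<integral>\<tau>. K * (indicator {0..s} \<tau> *\<^sub>R N s \<tau>) \<partial>lebesgue)"
      using Nabs unfolding set_integrable_def
    proof (intro integral_mono integrable_norm G_int integrable_mult_right)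
      show "norm (G s \<tau>) \<le> K * (indicator {0..s} \<tau> *\<^sub>R N s \<tau>)" for \<tau>
        using mult_mono[OF deriv_bound[of s \<tau>] K[of \<tau>]] True deriv_bound[of s \<tau>]
        by (auto simp: G_eq abs_mult mult.commute split: split_indicator)
    qed
    also have "\<dots> = K * integral {0..s} (N s)"
      using set_lebesgue_integral_eq_integral(2)[OF Nabs] by (simp add: set_lebesgue_integral_def)
    finally show ?thesis
      using True by simp
  qed (simp add: G_eq)
  have norm_meas: "(\<lambda>s. \<integral>\<tau>. norm (G s \<tau>) \<partial>lebesgue) \<in> borel_measurable lborel"
    using G_meas by (intro lborel_lebesgue.M2.borel_measurable_lebesgue_integral) (simp add: case_prod_beta')
  have pair_int: "integrable (lborel \<Otimes>\<^sub>M lebesgue) (case_prod G)"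
  proof (rule lborel_lebesgue.Fubini_integrable[OF G_meas])
    have "(\<lambda>s. K * integral {0..s} (N s)) absolutely_integrable_on {0..T}"
    proof (rule set_integrable_mult_right)
      show "(\<lambda>s. integral {0..s} (N s)) absolutely_integrable_on {0..T}"
        using bound_integrable deriv_bound bound_integral_integrable[OF T]
        by (intro nonnegative_absolutely_integrable_1)
           (auto intro!: Henstock_Kurzweil_Integration.integral_nonneg intro: order_trans[OF abs_ge_zero])
    qed
    then have "integrable lebesgue (\<lambda>s. indicator {0..T} s * (K * integral {0..s} (N s)))"
      by (simp add: set_integrable_def)
    then have "integrable lebesgue (\<lambda>s. \<integral>\<tau>. norm (G s \<tau>) \<partial>lebesgue)"
    proof (rule Bochner_Integration.integrable_bound)
      show "(\<lambda>s. \<integral>\<tau>. norm (G s \<tau>) \<partial>lebesgue) \<in> borel_measurable lebesgue"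
        by (rule measurable_completion[OF norm_meas])
      show "AE s in lebesgue. norm (\<integral>\<tau>. norm (G s \<tau>) \<partial>lebesgue) \<le> norm (indicator {0..T} s * (K * integral {0..s} (N s)))"
        using G_norm by (intro AE_I2) (smt (verit) real_norm_def Bochner_Integration.integral_nonneg norm_ge_zero)
    qed
    \<comment> \<open>The comparison took place in \<open>lebesgue\<close>; Borel measurability of
      the inner integral brings it back to \<open>lborel\<close>.\<close>
    then show "integrable lborel (\<lambda>s. \<integral>\<tau>. norm (case (s, \<tau>) of (s, \<tau>) \<Rightarrow> G s \<tau>) \<partial>lebesgue)"
      using integrable_completion[OF norm_meas] by simp
  qed (simp add: G_int)
  have G_memory: "(\<integral>\<tau>. G s \<tau> \<partial>lebesgue) = indicator {0..T} s * memory_term y s" for s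
  proof (cases "s \<in> {0..T}")
    case True
    then show ?thesis
      using set_lebesgue_integral_eq_integral(2)[OF deriv_times_absolutely_integrable[OF _ y, of s]]
      by (simp add: G_eq memory_term_def set_lebesgue_integral_def)
  qed (simp add: G_eq)
  have memory_lborel: "integrable lborel (\<lambda>s. indicator {0..T} s * memory_term y s)"
    using lborel_lebesgue.integrable_fst[OF pair_int] by (simp add: G_memory)
  then show memory: "memory_term y absolutely_integrable_on {0..T}"
    using integrable_completion[of "\<lambda>s. indicator {0..T} s * memory_term y s" lborel]
    by (auto simp: set_integrable_def)
  \<comment> \<open>A derivative is always gauge integrable, with its increment as integral. This
    equals the Lebesgue integral when the section is integrable, which Fubini guarantees for almost
    every \<open>\<tau>\<close>.\<close>
  have G_diff: "(\<integral>s. G s \<tau> \<partial>lborel) = indicator {0..T} \<tau> * ((a T \<tau> - a \<tau> \<tau>) * y \<tau>)"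
    if "integrable lborel (\<lambda>s. G s \<tau>)" for \<tau>
  proof (cases "\<tau> \<in> {0..T}")
    case True
    have "((\<lambda>s. c s \<tau>) has_integral (a T \<tau> - a \<tau> \<tau>)) {\<tau>..T}"
      using True
      by (intro fundamental_theorem_of_calculus has_vector_derivative_within_subset[OF deriv]) auto
    then have "((\<lambda>s. c s \<tau> * y \<tau>) has_integral ((a T \<tau> - a \<tau> \<tau>) * y \<tau>)) {\<tau>..T}"
      by (rule has_integral_mult_left)
    moreover have "(\<lambda>s. if s \<in> {\<tau>..T} then c s \<tau> * y \<tau> else 0) = (\<lambda>s. G s \<tau>)"
      using True by (auto simp: G_eq split: split_indicator)
    ultimately have "((\<lambda>s. G s \<tau>) has_integral ((a T \<tau> - a \<tau> \<tau>) * y \<tau>)) UNIV"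
      using has_integral_restrict_UNIV[of "{\<tau>..T}" "\<lambda>s. c s \<tau> * y \<tau>"] by simp
    with has_integral_integral_lborel[OF that] True show ?thesis
      by (auto dest: has_integral_unique)
  next
    case False
    then have "G s \<tau> = 0" for s
      by (auto simp: G_eq split: split_indicator)
    with False show ?thesis
      by simp
  qed
  have AE: "AE \<tau> in lebesgue. (\<integral>s. G s \<tau> \<partial>lborel) = indicator {0..T} \<tau> * ((a T \<tau> - a \<tau> \<tau>) * y \<tau>)"
    using lborel_lebesgue.AE_integrable_snd[OF pair_int] by eventually_elim (rule G_diff)
  have snd_int: "integrable lebesgue (\<lambda>\<tau>. \<integral>s. G s \<tau> \<partial>lborel)"
    by (rule lborel_lebesgue.integrable_snd[OF pair_int])
  \<comment> \<open>Measurability of the diagonal enters here: the function agrees almost everywhere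
    with a measurable one, and \<open>lebesgue\<close> is complete.\<close>
  have diff_meas: "(\<lambda>\<tau>. indicator {0..T} \<tau> * ((a T \<tau> - a \<tau> \<tau>) * y \<tau>)) \<in> borel_measurable lebesgue"
    by (rule borel_measurable_AE[OF borel_measurable_integrable[OF snd_int] AE])
  show diff: "(\<lambda>\<tau>. (a T \<tau> - a \<tau> \<tau>) * y \<tau>) absolutely_integrable_on {0..T}"
    using integrable_cong_AE_imp[OF snd_int diff_meas AE] by (simp add: set_integrable_def)
  have "integral {0..T} (memory_term y) = (\<integral>s. indicator {0..T} s * memory_term y s \<partial>lebesgue)"
    using set_lebesgue_integral_eq_integral(2)[OF memory] by (simp add: set_lebesgue_integral_def)
  also have "\<dots> = (\<integral>s. indicator {0..T} s * memory_term y s \<partial>lborel)"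
    using memory_lborel by (intro integral_completion) auto
  also have "\<dots> = (\<integral>\<tau>. (\<integral>s. G s \<tau> \<partial>lborel) \<partial>lebesgue)"
    using lborel_lebesgue.Fubini_integral[OF pair_int] by (simp add: G_memory)
  also have "\<dots> = (\<integral>\<tau>. indicator {0..T} \<tau> * ((a T \<tau> - a \<tau> \<tau>) * y \<tau>) \<partial>lebesgue)"
    using snd_int diff_meas AE by (intro integral_cong_AE) auto
  also have "\<dots> = integral {0..T} (\<lambda>\<tau>. (a T \<tau> - a \<tau> \<tau>) * y \<tau>)"
    using set_lebesgue_integral_eq_integral(2)[OF diff] by (simp add: set_lebesgue_integral_def)
  finally show "integral {0..T} (memory_term y) = integral {0..T} (\<lambda>\<tau>. (a T \<tau> - a \<tau> \<tau>) * y \<tau>)" .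
qed

text \<open>The case \<open>y = 1\<close> of Fubini's theorem controls
  \<open>a T \<tau> - a \<tau> \<tau>\<close>; subtracting this from \<open>a T \<tau>\<close>
  leaves the diagonal.\<close>

lemma diagonal_absolutely_integrable:
  assumes "0 \<le> T"
  shows "(\<lambda>\<tau>. a \<tau> \<tau>) absolutely_integrable_on {0..T}"
proof -
  have "(\<lambda>\<tau>. a T \<tau> - a \<tau> \<tau>) absolutely_integrable_on {0..T}"
    using fubini_kernel(2)[of "\<lambda>_. 1" T] assms by simp
  from set_integral_diff(1)[OF kernel_integrable[OF assms] this] show ?thesis
    by simp
qed

text \<open>The integrated Leibniz rule: \<open>T\<close> no longer occurs under the integral
  sign.\<close>

lemma volterra_integral_eq:
  assumes y: "continuous_on {0..} y" and T: "0 \<le> T"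
  shows "integral {0..T} (\<lambda>\<tau>. a T \<tau> * y \<tau>) = integral {0..T} (\<lambda>\<tau>. a \<tau> \<tau> * y \<tau> + memory_term y \<tau>)"
proof -
  note int = times_continuous_absolutely_integrable[OF kernel_integrable[OF T] y]
    times_continuous_absolutely_integrable[OF diagonal_absolutely_integrable[OF T] y] fubini_kernel(1)[OF y T]
  note int = int[THEN set_lebesgue_integral_eq_integral(1)]
  have "integral {0..T} (memory_term y) = integral {0..T} (\<lambda>\<tau>. a T \<tau> * y \<tau> - a \<tau> \<tau> * y \<tau>)"
    by (simp add: fubini_kernel(3)[OF y T] left_diff_distrib)
  also have "\<dots> = integral {0..T} (\<lambda>\<tau>. a T \<tau> * y \<tau>) - integral {0..T} (\<lambda>\<tau>. a \<tau> \<tau> * y \<tau>)"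
    by (intro Henstock_Kurzweil_Integration.integral_diff int)
  finally show ?thesis
    by (simp add: Henstock_Kurzweil_Integration.integral_add[OF int(2,3)])
qed

end

section \<open>Perturbed Volterra systems\<close>

lemma volterra_kernel_differentiable_kernel:
  assumes "volterra_kernel b"
  shows "differentiable_kernel (b k l) (\<lambda>t \<tau>. kernel_deriv b t \<tau> $ k $ l) (\<lambda>t \<tau>. op_infnorm (kernel_deriv b t \<tau>))"
proof
  show "((\<lambda>s. b k l s \<tau>) has_vector_derivative kernel_deriv b t \<tau> $ k $ l) (at t within {\<tau>..})"
    if "0 \<le> \<tau>" "\<tau> \<le> t" for \<tau> t
    using assms that by (simp add: volterra_kernel_def kernel_deriv_def vector_derivative_works[symmetric])
qed (use assms in \<open>auto simp: volterra_kernel_def component_le_op_infnorm\<close>)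

text \<open>The right-hand side of the differentiated system. \<open>X\<close> is treated only as an
  indefinite integral of it and is never differentiated itself.\<close>

definition rate ::
    "('n \<Rightarrow> 'n \<Rightarrow> real \<Rightarrow> real \<Rightarrow> real) \<Rightarrow> (real \<Rightarrow> real ^ 'n) \<Rightarrow> (real \<Rightarrow> real ^ 'n) \<Rightarrow> 'n \<Rightarrow> real \<Rightarrow> real" where
  "rate b F X k t =
     (\<Sum>l\<in>UNIV. kernel_diag b t $ k $ l * X t $ l
        + integral {0..t} (\<lambda>\<tau>. kernel_deriv b t \<tau> $ k $ l * X \<tau> $ l)) + deriv_nonneg F t $ k"

locale perturbed_volterra =
  fixes b :: "'n::finite \<Rightarrow> 'n \<Rightarrow> real \<Rightarrow> real \<Rightarrow> real" and F X :: "real \<Rightarrow> real ^ 'n"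
  assumes kernel: "volterra_kernel b"
    and F_diff: "F differentiable_on {0..}" and F'_cont: "continuous_on {0..} (deriv_nonneg F)"
    and solution: "volterra_solution b F X"
begin

lemma X_cont: "continuous_on {0..} X"
  using solution by (simp add: volterra_solution_def)

lemma X_component_cont: "continuous_on {0..} (\<lambda>t. X t $ k)"
  by (intro continuous_intros X_cont)

text \<open>Sums the integrated Leibniz rule over the entries of row \<open>k\<close> and adds the
  fundamental theorem of calculus for \<open>F\<close>.\<close>

lemma rate_integral:
  assumes T: "0 \<le> T"
  shows "rate b F X k integrable_on {0..T}"
    and "X T $ k = F 0 $ k + integral {0..T} (rate b F X k)"
proof -
  define h where "h l t = b k l t t * X t $ l + integral {0..t} (\<lambda>\<tau>. kernel_deriv b t \<tau> $ k $ l * X \<tau> $ l)" for l t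
  have h: "h l integrable_on {0..T}" "integral {0..T} (\<lambda>\<tau>. b k l T \<tau> * X \<tau> $ l) = integral {0..T} (h l)" for l
  proof -
    interpret differentiable_kernel "b k l" "\<lambda>t \<tau>. kernel_deriv b t \<tau> $ k $ l" "\<lambda>t \<tau>. op_infnorm (kernel_deriv b t \<tau>)"
      by (rule volterra_kernel_differentiable_kernel[OF kernel])
    show "integral {0..T} (\<lambda>\<tau>. b k l T \<tau> * X \<tau> $ l) = integral {0..T} (h l)"
      using volterra_integral_eq[OF X_component_cont T] by (simp add: h_def[abs_def] memory_term_def)
    show "h l integrable_on {0..T}"
      using set_integral_add(1)[OF times_continuous_absolutely_integrable[OF diagonal_absolutely_integrable[OF T] X_component_cont]
          fubini_kernel(1)[OF X_component_cont T]]
      by (simp add: h_def[abs_def] memory_term_def set_lebesgue_integral_eq_integral(1))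
  qed
  have "(F has_vector_derivative deriv_nonneg F t) (at t within {0..T})" if "t \<in> {0..T}" for t
  proof -
    have "(F has_vector_derivative deriv_nonneg F t) (at t within {0..})"
      using F_diff that by (auto simp: deriv_nonneg_def differentiable_on_def vector_derivative_works[symmetric])
    then show ?thesis
      by (rule has_vector_derivative_within_subset) auto
  qed
  then have F: "((\<lambda>t. deriv_nonneg F t $ k) has_integral (F T $ k - F 0 $ k)) {0..T}"
    using T by (intro fundamental_theorem_of_calculus bounded_linear.has_vector_derivative[OF bounded_linear_vec_nth])
  have rate: "rate b F X k = (\<lambda>t. (\<Sum>l\<in>UNIV. h l t) + deriv_nonneg F t $ k)"
    by (auto simp: rate_def h_def kernel_diag_def)
  have int: "(rate b F X k has_integral ((\<Sum>l\<in>UNIV. integral {0..T} (h l)) + (F T $ k - F 0 $ k))) {0..T}"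
    unfolding rate using h(1) by (intro has_integral_add F has_integral_sum) (auto simp: integrable_integral)
  then show "rate b F X k integrable_on {0..T}"
    by blast
  show "X T $ k = F 0 $ k + integral {0..T} (rate b F X k)"
    using solution T by (simp add: integral_unique[OF int] volterra_solution_def h(2))
qed

section \<open>Estimates along a solution\<close>

lemma phi_star_integrable:
  assumes "0 \<le> T"
  shows "phi_star b F \<epsilon> integrable_on {0..T}"
proof -
  have "continuous_on {0..T} (\<lambda>s. infnorm (deriv_nonneg F s))"
    using continuous_on_subset[OF F'_cont] by (intro continuous_intros) auto
  from integrable_on_divide[OF integrable_continuous_real[OF this]]
  show ?thesis
    unfolding phi_star_def[abs_def]
    using kernel assms by (intro integrable_add) (auto simp: volterra_kernel_def)
qed

text \<open>The instantaneous, memory and forcing terms together contribute at most \<open>M\<close>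
  times the nonpositive sum in the hypothesis, plus the diagonal gap term.\<close>

lemma rate_le:
  assumes t: "0 \<le> t" and \<epsilon>: "0 < \<epsilon>" "\<epsilon> \<le> M" and X: "\<And>\<tau>. \<tau> \<in> {0..t} \<Longrightarrow> infnorm (X \<tau>) \<le> M"
    and le: "log_norm (kernel_diag b t) + phi_star b F \<epsilon> t \<le> 0" and \<sigma>: "\<bar>\<sigma>\<bar> = 1"
  shows "\<sigma> * rate b F X k t \<le> \<bar>b k k t t\<bar> * (M - \<sigma> * X t $ k)"
proof -
  define C where "C = integral {0..t} (\<lambda>\<tau>. op_infnorm (kernel_deriv b t \<tau>))"
  have diag: "\<sigma> * (\<Sum>l\<in>UNIV. kernel_diag b t $ k $ l * X t $ l)
      \<le> log_norm (kernel_diag b t) * M + \<bar>b k k t t\<bar> * (M - \<sigma> * X t $ k)"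
    using matrix_row_le_log_norm[OF X[of t] \<sigma>, of "kernel_diag b t" k] t by (simp add: kernel_diag_def)
  have int: "(\<lambda>\<tau>. kernel_deriv b t \<tau> $ k $ l * X \<tau> $ l) integrable_on {0..t}" for l
  proof -
    interpret differentiable_kernel "b k l" "\<lambda>t \<tau>. kernel_deriv b t \<tau> $ k $ l" "\<lambda>t \<tau>. op_infnorm (kernel_deriv b t \<tau>)"
      by (rule volterra_kernel_differentiable_kernel[OF kernel])
    show ?thesis
      using deriv_times_absolutely_integrable[OF t X_component_cont] set_lebesgue_integral_eq_integral(1) by blast
  qed
  have "\<sigma> * (\<Sum>l\<in>UNIV. integral {0..t} (\<lambda>\<tau>. kernel_deriv b t \<tau> $ k $ l * X \<tau> $ l))
      = integral {0..t} (\<lambda>\<tau>. \<sigma> * (\<Sum>l\<in>UNIV. kernel_deriv b t \<tau> $ k $ l * X \<tau> $ l))"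
    using int by (simp add: integral_sum)
  also have "\<dots> \<le> integral {0..t} (\<lambda>\<tau>. op_infnorm (kernel_deriv b t \<tau>) * M)"
  proof (rule integral_le)
    show "(\<lambda>\<tau>. op_infnorm (kernel_deriv b t \<tau>) * M) integrable_on {0..t}"
      using kernel t by (intro integrable_on_mult_left) (auto simp: volterra_kernel_def)
    show "(\<lambda>\<tau>. \<sigma> * (\<Sum>l\<in>UNIV. kernel_deriv b t \<tau> $ k $ l * X \<tau> $ l)) integrable_on {0..t}"
      using int by (intro integrable_on_mult_right integrable_sum) auto
    show "\<sigma> * (\<Sum>l\<in>UNIV. kernel_deriv b t \<tau> $ k $ l * X \<tau> $ l) \<le> op_infnorm (kernel_deriv b t \<tau>) * M"
      if "\<tau> \<in> {0..t}" for \<tau>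
      using abs_ge_self[of "\<sigma> * (\<Sum>l\<in>UNIV. kernel_deriv b t \<tau> $ k $ l * X \<tau> $ l)"]
        abs_matrix_row_le[OF X[OF that], of "kernel_deriv b t \<tau>" k] \<sigma> by (simp add: abs_mult)
  qed
  finally have memory: "\<sigma> * (\<Sum>l\<in>UNIV. integral {0..t} (\<lambda>\<tau>. kernel_deriv b t \<tau> $ k $ l * X \<tau> $ l)) \<le> C * M"
    by (simp add: C_def)
  have "\<sigma> * deriv_nonneg F t $ k \<le> infnorm (deriv_nonneg F t)"
    using abs_ge_self[of "\<sigma> * deriv_nonneg F t $ k"] component_le_infnorm_cart[of "deriv_nonneg F t" k] \<sigma>
    by (simp add: abs_mult)
  \<comment> \<open>Here \<open>\<epsilon> \<le> M\<close> is used: the forcing is absorbed because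
    the solution has already reached size \<open>\<epsilon>\<close>.\<close>
  also have "\<dots> \<le> infnorm (deriv_nonneg F t) / \<epsilon> * M"
    using mult_left_mono[OF \<epsilon>(2) infnorm_pos_le[of "deriv_nonneg F t"]] \<epsilon>(1) by (simp add: field_simps)
  finally have forcing: "\<sigma> * deriv_nonneg F t $ k \<le> infnorm (deriv_nonneg F t) / \<epsilon> * M" .
  have "(log_norm (kernel_diag b t) + (C + infnorm (deriv_nonneg F t) / \<epsilon>)) * M \<le> 0"
    using le \<epsilon> by (intro mult_nonpos_nonneg) (auto simp: phi_star_def C_def)
  with diag memory forcing show ?thesis
    by (simp add: rate_def sum.distrib algebra_simps)
qed

lemma solution_bounded:
  assumes \<epsilon>: "0 < \<epsilon>" and F0: "infnorm (F 0) \<le> \<epsilon>" and stab: "stability_condition b F \<epsilon>" and T: "0 \<le> T"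
  shows "infnorm (X T) \<le> \<epsilon>"
proof (rule ccontr)
  assume "\<not> infnorm (X T) \<le> \<epsilon>"
  have "continuous_on {0..T} (\<lambda>t. infnorm (X t))"
    using continuous_on_subset[OF X_cont] by (intro continuous_intros) auto
  then obtain t where t: "t \<in> {0..T}" and max: "\<And>s. s \<in> {0..T} \<Longrightarrow> infnorm (X s) \<le> infnorm (X t)"
    using continuous_attains_sup[of "{0..T}" "\<lambda>t. infnorm (X t)"] T by auto
  define M where "M = infnorm (X t)"
  have "\<epsilon> < M"
    using max[of T] T \<open>\<not> infnorm (X T) \<le> \<epsilon>\<close> by (simp add: M_def)
  \<comment> \<open>The rate at a time up to \<open>t\<close> depends on \<open>X\<close> over
    \<open>{0..t}\<close> only, so later values can be ignored.\<close>
  have X_le: "infnorm (X s) \<le> M" if "s \<in> {0..t}" for s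
    using max[of s] that t by (auto simp: M_def)
  obtain k where k: "M = \<bar>X t $ k\<bar>"
    unfolding M_def using infnorm_cart_attained by blast
  define \<sigma> :: real where "\<sigma> = (if 0 \<le> X t $ k then 1 else - 1)"
  have \<sigma>: "\<bar>\<sigma>\<bar> = 1" "\<sigma> * X t $ k = M"
    by (auto simp: \<sigma>_def k)
  define u where "u s = M - \<sigma> * X s $ k" for s
  define \<beta> where "\<beta> s = \<bar>b k k s s\<bar>" for s
  have X_abs: "\<bar>\<sigma> * x $ k\<bar> \<le> m" if "infnorm x \<le> m" for x m
    using that \<sigma> component_le_infnorm_cart[of x k] by (simp add: abs_mult)
  have u_cont: "continuous_on {0..} u"
    unfolding u_def[abs_def] by (intro continuous_intros X_cont)
  interpret differentiable_kernel "b k k" "\<lambda>t \<tau>. kernel_deriv b t \<tau> $ k $ k" "\<lambda>t \<tau>. op_infnorm (kernel_deriv b t \<tau>)"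
    by (rule volterra_kernel_differentiable_kernel[OF kernel])
  have \<beta>: "\<beta> absolutely_integrable_on {0..t}"
    using set_integrable_abs[OF diagonal_absolutely_integrable, of t] t by (simp add: \<beta>_def[abs_def])
  have \<beta>u: "(\<lambda>r. \<beta> r * u r) integrable_on {0..t}"
    using times_continuous_absolutely_integrable[OF \<beta> u_cont] set_lebesgue_integral_eq_integral(1) by blast
  \<comment> \<open>The strict inequality becomes a weak one in the limit, which is all that
    \<open>rate_le\<close> requires.\<close>
  have "AE r in lebesgue. 0 < r \<longrightarrow> log_norm (kernel_diag b r) + phi_star b F \<epsilon> r \<le> 0"
    by (rule AE_left_average_le[OF phi_star_integrable])
       (use stab in \<open>auto simp: stability_condition_def less_imp_le\<close>)
  \<comment> \<open>Left averages exist only at positive times; the single point 0 is null.\<close>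
  moreover have "AE r in lebesgue. r \<noteq> (0::real)"
    by (intro AE_completion AE_lborel_singleton)
  ultimately have rate_AE: "AE r in lebesgue. r \<in> {0..t} \<longrightarrow> \<sigma> * rate b F X k r \<le> \<beta> r * u r"
  proof eventually_elim
    case (elim r)
    show ?case
    proof
      assume "r \<in> {0..t}"
      then show "\<sigma> * rate b F X k r \<le> \<beta> r * u r"
        unfolding \<beta>_def u_def using elim \<epsilon> \<open>\<epsilon> < M\<close> X_le \<sigma>(1) by (intro rate_le[of r \<epsilon>]) auto
    qed
  qed
  have "0 < u t"
  proof (rule positive_if_integral_decay[where T = t and t = t and u = u and \<beta> = \<beta>])
    show "continuous_on {0..t} u"
      by (rule continuous_on_subset[OF u_cont]) auto
    have "X 0 = F 0"
      using rate_integral(2)[of 0] by (simp add: vec_eq_iff)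
    then show "0 < u 0"
      using X_abs[OF F0] \<open>\<epsilon> < M\<close> by (simp add: u_def)
    show "0 \<le> u s" if "s \<in> {0..t}" for s
      using X_abs[OF X_le[OF that]] by (simp add: u_def)
    show "u s - integral {s..r} (\<lambda>q. \<beta> q * u q) \<le> u r" if "0 \<le> s" "s \<le> r" "r \<le> t" for s r
    proof -
      have sub: "{s..r} \<subseteq> {0..t}" and int: "rate b F X k integrable_on {s..r}"
        using that integrable_on_subinterval[OF rate_integral(1), of r] by auto
      have "integral {0..s} (rate b F X k) + integral {s..r} (rate b F X k) = integral {0..r} (rate b F X k)"
        using that by (intro Henstock_Kurzweil_Integration.integral_combine rate_integral(1)) auto
      then have "X r $ k - X s $ k = integral {s..r} (rate b F X k)"
        using that rate_integral(2)[of r k] rate_integral(2)[of s k] by simp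
      then have "\<sigma> * X r $ k - \<sigma> * X s $ k = integral {s..r} (\<lambda>q. \<sigma> * rate b F X k q)"
        by (simp add: right_diff_distrib[symmetric])
      also have "\<dots> \<le> integral {s..r} (\<lambda>q. \<beta> q * u q)"
        using rate_AE sub
        by (intro integral_le_AE integrable_on_mult_right int integrable_on_subinterval[OF \<beta>u sub])
           (auto elim!: eventually_mono)
      finally show ?thesis
        by (simp add: u_def)
    qed
  qed (use \<beta> \<beta>u t set_lebesgue_integral_eq_integral(1)[OF \<beta>] in \<open>auto simp: \<beta>_def\<close>)
  then show False
    using \<sigma>(2) by (simp add: u_def)
qed

end

theorem theorem2:
  fixes b :: "'n::finite \<Rightarrow> 'n \<Rightarrow> real \<Rightarrow> real \<Rightarrow> real"
    and \<delta>\<^sub>1 \<delta>\<^sub>2 :: "real \<Rightarrow> real"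
    and \<epsilon>\<^sub>0 :: real
  assumes "volterra_kernel b"
    and "\<epsilon>\<^sub>0 > 0"
    and "\<And>\<epsilon>. 0 < \<epsilon> \<Longrightarrow> \<epsilon> < \<epsilon>\<^sub>0 \<Longrightarrow> \<delta>\<^sub>1 \<epsilon> > 0"
    and "\<And>\<epsilon>. 0 < \<epsilon> \<Longrightarrow> \<epsilon> < \<epsilon>\<^sub>0 \<Longrightarrow> \<delta>\<^sub>2 \<epsilon> > 0"
    and "\<And>\<epsilon>. 0 < \<epsilon> \<Longrightarrow> \<epsilon> < \<epsilon>\<^sub>0 \<Longrightarrow> \<delta>\<^sub>2 \<epsilon> \<le> \<epsilon>"
  shows "((\<forall>\<epsilon> F. 0 < \<epsilon> \<longrightarrow> \<epsilon> < \<epsilon>\<^sub>0 \<longrightarrow> perturbation (\<delta>\<^sub>1 \<epsilon>) (\<delta>\<^sub>2 \<epsilon>) F \<longrightarrow> stability_condition b F \<epsilon>)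
            \<longrightarrow> trivial_solution_stable b) \<and>
         (\<forall>\<epsilon> F X. 0 < \<epsilon> \<longrightarrow> \<epsilon> < \<epsilon>\<^sub>0 \<longrightarrow> perturbation (\<delta>\<^sub>1 \<epsilon>) (\<delta>\<^sub>2 \<epsilon>) F \<longrightarrow>
            stability_condition b F \<epsilon> \<longrightarrow> volterra_solution b F X \<longrightarrow>
            (\<forall>t\<ge>0. infnorm (X t) \<le> \<epsilon>))"
proof -
  have bounded: "infnorm (X t) \<le> \<epsilon>"
    if "0 < \<epsilon>" "\<epsilon> < \<epsilon>\<^sub>0" "perturbation (\<delta>\<^sub>1 \<epsilon>) (\<delta>\<^sub>2 \<epsilon>) F" "stability_condition b F \<epsilon>"
      "volterra_solution b F X" "0 \<le> t" for \<epsilon> F X t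
  proof -
    interpret perturbed_volterra b F X
      using that assms(1) by unfold_locales (auto simp: perturbation_def)
    show ?thesis
      using that assms(5)[of \<epsilon>] by (intro solution_bounded) (auto simp: perturbation_def)
  qed
  have "trivial_solution_stable b"
    if stab: "\<forall>\<epsilon> F. 0 < \<epsilon> \<longrightarrow> \<epsilon> < \<epsilon>\<^sub>0 \<longrightarrow> perturbation (\<delta>\<^sub>1 \<epsilon>) (\<delta>\<^sub>2 \<epsilon>) F \<longrightarrow> stability_condition b F \<epsilon>"
    unfolding trivial_solution_stable_def
  proof (intro allI impI)
    fix \<epsilon> :: real assume "0 < \<epsilon>"
    \<comment> \<open>The condition is available only below \<open>\<epsilon>\<^sub>0\<close>, so a
      large \<open>\<epsilon>\<close> is served by a smaller bound; halving makes
      \<open>e < \<epsilon>\<^sub>0\<close> strict.\<close>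
    define e where "e = min \<epsilon> (\<epsilon>\<^sub>0 / 2)"
    have e: "0 < e" "e < \<epsilon>\<^sub>0" "e \<le> \<epsilon>"
      using \<open>0 < \<epsilon>\<close> assms(2) by (auto simp: e_def)
    have "\<forall>F X. perturbation (\<delta>\<^sub>1 e) (\<delta>\<^sub>2 e) F \<longrightarrow> volterra_solution b F X \<longrightarrow> (\<forall>t\<ge>0. infnorm (X t) \<le> \<epsilon>)"
      using bounded[OF e(1,2)] stab e by (meson order_trans)
    moreover have "\<delta>\<^sub>2 e \<le> \<epsilon>"
      using assms(5)[OF e(1,2)] e(3) by linarith
    ultimately show "\<exists>d1>0. \<exists>d2>0. d2 \<le> \<epsilon> \<and>
        (\<forall>F X. perturbation d1 d2 F \<longrightarrow> volterra_solution b F X \<longrightarrow> (\<forall>t\<ge>0. infnorm (X t) \<le> \<epsilon>))"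
      using assms(3,4)[OF e(1,2)] by blast
  qed
  with bounded show ?thesis
    by blast
qed

end
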